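(* Under the duality data of the context, for each orbit $O=\{z,\sigma(z)\}$ (coordinates ordered as $(z,\sigma(z))$) the matrix $$M_O=\begin{pmatrix}1-C^\ast&-C^\ast\kappa(z)\\-C^\ast\kappa(\sigma(z))&1-C^\ast\end{pmatrix},\qquad C^\ast=\frac1{1+\sqrt K},$$ has rank exactly one, with $$\operatorname{im}M_O=\mathbb R\,\mathbf d_O,\quad \mathbf d_O:=\big(\sqrt{\kappa(z)},-\sqrt{\kappa(\sigma(z))}\big),\qquad \ker M_O=\mathbb R\big(\sqrt{\kappa(z)},\sqrt{\kappa(\sigma(z))}\big).$$ Consequently, for every $\nu$ the pair $([\mathbf n_\nu]_z,[\mathbf n_\nu]_{\sigma(z)})$ is a scalar multiple of $\mathbf d_O$.
   Context: $Z$ is a finite set of sites with an involution $\sigma:Z\to Z$; an orbit is a pair $\{z,\sigma(z)\}$ with $\sigma(z)\ne z$. There are weights $\kappa(z)>0$ and a constant $K>0$ with $\kappa(z)\kappa(\sigma(z))=K$ for all $z\in Z$. For real coefficients $A_\nu(z)$ ($\nu=1,\dots,N$, $z\in Z$), with dual coefficients $B_\nu(z)=\kappa(z)A_\nu(\sigma(z))$, the normal directions are the vectors $\mathbf n_\nu\in\mathbb R^Z$ with $[\mathbf n_\nu]_z=(1-C^\ast)A_\nu(z)-C^\ast\kappa(z)A_\nu(\sigma(z))$. *)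

theory Defs
  imports "HOL-Analysis.Analysis"
begin

definition c_star :: "real \<Rightarrow> real" where
  "c_star K = 1 / (1 + sqrt K)"

definition dual_coeff :: "('z \<Rightarrow> 'z) \<Rightarrow> ('z \<Rightarrow> real) \<Rightarrow> ('z \<Rightarrow> real) \<Rightarrow> 'z \<Rightarrow> real" where
  "dual_coeff \<sigma> \<kappa> A z = \<kappa> z * A (\<sigma> z)"

text \<open>Elements of \<open>\<real>\<^sup>Z\<close> are functions that are extensional on the carrier \<open>Z\<close>.\<close>

definition normal_dir ::
    "'z set \<Rightarrow> ('z \<Rightarrow> 'z) \<Rightarrow> ('z \<Rightarrow> real) \<Rightarrow> real \<Rightarrow> ('z \<Rightarrow> real) \<Rightarrow> 'z \<Rightarrow> real" where
  "normal_dir Z \<sigma> \<kappa> K A = (\<lambda>z\<in>Z. (1 - c_star K) * A z - c_star K * dual_coeff \<sigma> \<kappa> A z)"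

text \<open>An orbit is given by a representative \<open>z\<close>; coordinates 1 and 2 belong to \<open>z\<close> and \<open>\<sigma> z\<close>.\<close>

definition orbit_matrix :: "('z \<Rightarrow> 'z) \<Rightarrow> ('z \<Rightarrow> real) \<Rightarrow> real \<Rightarrow> 'z \<Rightarrow> real^2^2" where
  "orbit_matrix \<sigma> \<kappa> K z =
     vector [vector [1 - c_star K, - (c_star K * \<kappa> z)],
             vector [- (c_star K * \<kappa> (\<sigma> z)), 1 - c_star K]]"

definition orbit_dir :: "('z \<Rightarrow> 'z) \<Rightarrow> ('z \<Rightarrow> real) \<Rightarrow> 'z \<Rightarrow> real^2" where
  "orbit_dir \<sigma> \<kappa> z = vector [sqrt (\<kappa> z), - sqrt (\<kappa> (\<sigma> z))]"

end

(* Since 1 - c_star K = sqrt K * c_star K and sqrt K = sqrt (\<kappa> z) * sqrt (\<kappa> (\<sigma> z)), the orbit matrix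
   is the outer product of the orbit direction with (sqrt (\<kappa> (\<sigma> z)), - sqrt (\<kappa> z)), scaled by c_star K.
   Image, kernel and rank are read off from this factorisation. *)
theory Submission
  imports Defs
begin

lemma c_star_pos: "K \<ge> 0 \<Longrightarrow> c_star K > 0"
  by (simp add: c_star_def add_pos_nonneg)

lemma orbit_matrix_mult_vec:
  fixes x :: "real^2"
  assumes "\<kappa> z > 0" and "\<kappa> (\<sigma> z) > 0" and "\<kappa> z * \<kappa> (\<sigma> z) = K"
  shows "orbit_matrix \<sigma> \<kappa> K z *v x =
    (c_star K * (sqrt (\<kappa> (\<sigma> z)) * x $ 1 - sqrt (\<kappa> z) * x $ 2)) *\<^sub>R orbit_dir \<sigma> \<kappa> z"
proof -
  define p q c where "p = sqrt (\<kappa> z)" and "q = sqrt (\<kappa> (\<sigma> z))" and "c = c_star K"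
  have pq: "p > 0" "q > 0" "\<kappa> z = p * p" "\<kappa> (\<sigma> z) = q * q"
    using assms by (simp_all add: p_def q_def)
  have "sqrt K = p * q"
    unfolding p_def q_def by (simp add: assms(3)[symmetric] real_sqrt_mult)
  moreover have "1 + p * q > 0"
    using pq by (simp add: add_pos_pos)
  ultimately have c: "1 - c = p * q * c"
    by (simp add: c_def c_star_def field_simps)
  show ?thesis
    \<comment> \<open>The roots are folded into \<open>p\<close> and \<open>q\<close>, and the
      diagonal entry becomes \<open>p * q * c\<close>, before the remaining \<kappa> values are
      replaced by squares; otherwise terms such as \<open>sqrt (p * p)\<close> would appear. Both
      coordinates are then polynomial identities in \<open>p\<close>, \<open>q\<close>,
      \<open>c\<close> and the entries of \<open>x\<close>.\<close>
    unfolding vec_eq_iff forall_2 orbit_matrix_def orbit_dir_def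
      c_def[symmetric] p_def[symmetric] q_def[symmetric] c
    unfolding pq(3,4)
    by (simp add: matrix_vector_mult_def sum_2 algebra_simps)
qed

lemma range_orbit_matrix:
  assumes "\<kappa> z > 0" and "\<kappa> (\<sigma> z) > 0" and "\<kappa> z * \<kappa> (\<sigma> z) = K"
  shows "range (\<lambda>x. orbit_matrix \<sigma> \<kappa> K z *v x) = span {orbit_dir \<sigma> \<kappa> z}"
proof -
  have c: "c_star K > 0"
    using assms by (auto intro: c_star_pos)
  have "t *\<^sub>R orbit_dir \<sigma> \<kappa> z \<in> range (\<lambda>x. orbit_matrix \<sigma> \<kappa> K z *v x)" for t
    using assms c
    \<comment> \<open>On a vector \<open>(s, 0)\<close> the scalar factor is
      \<open>c_star K * sqrt (\<kappa> (\<sigma> z)) * s\<close>; the witness solves for this to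
      equal \<open>t\<close>.\<close>
    by (intro range_eqI[of _ _ "vector [t / (c_star K * sqrt (\<kappa> (\<sigma> z))), 0]"])
      (simp add: orbit_matrix_mult_vec[of \<kappa> z \<sigma> K, OF assms])
  then show ?thesis
    by (auto simp: span_singleton orbit_matrix_mult_vec[of \<kappa> z \<sigma> K, OF assms])
qed

text \<open>Makes the image a genuine line, so that the rank is 1 and not 0, and lets the kernel
  condition be tested on the scalar factor alone.\<close>

lemma orbit_dir_nonzero: "\<kappa> z > 0 \<Longrightarrow> orbit_dir \<sigma> \<kappa> z \<noteq> 0"
  by (simp add: orbit_dir_def vec_eq_iff forall_2)

lemma rank_orbit_matrix:
  assumes "\<kappa> z > 0" and "\<kappa> (\<sigma> z) > 0" and "\<kappa> z * \<kappa> (\<sigma> z) = K"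
  shows "rank (orbit_matrix \<sigma> \<kappa> K z) = 1"
  by (simp add: rank_dim_range range_orbit_matrix[of \<kappa> z \<sigma> K, OF assms]
      orbit_dir_nonzero[of \<kappa>, OF assms(1)]
      dim_eq_card_independent)

lemma kernel_orbit_matrix:
  assumes "\<kappa> z > 0" and "\<kappa> (\<sigma> z) > 0" and "\<kappa> z * \<kappa> (\<sigma> z) = K"
  shows "{x. orbit_matrix \<sigma> \<kappa> K z *v x = 0} = span {vector [sqrt (\<kappa> z), sqrt (\<kappa> (\<sigma> z))]}"
proof -
  have c: "c_star K > 0"
    using assms by (auto intro: c_star_pos)
  have "orbit_matrix \<sigma> \<kappa> K z *v x = 0 \<longleftrightarrow>
      (\<exists>t. x = t *\<^sub>R vector [sqrt (\<kappa> z), sqrt (\<kappa> (\<sigma> z))])" for x :: "real^2"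
  proof -
    have "orbit_matrix \<sigma> \<kappa> K z *v x = 0 \<longleftrightarrow>
        sqrt (\<kappa> (\<sigma> z)) * x $ 1 = sqrt (\<kappa> z) * x $ 2"
      using c by (simp add: orbit_matrix_mult_vec[of \<kappa> z \<sigma> K, OF assms]
          orbit_dir_nonzero[of \<kappa>, OF assms(1)])
    also have "\<dots> \<longleftrightarrow> (\<exists>t. x $ 1 = t * sqrt (\<kappa> z) \<and> x $ 2 = t * sqrt (\<kappa> (\<sigma> z)))"
    proof
      assume "sqrt (\<kappa> (\<sigma> z)) * x $ 1 = sqrt (\<kappa> z) * x $ 2"
      then show "\<exists>t. x $ 1 = t * sqrt (\<kappa> z) \<and> x $ 2 = t * sqrt (\<kappa> (\<sigma> z))"
        \<comment> \<open>The first coordinate forces this value of \<open>t\<close>; the linear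
          relation between the coordinates then yields the second.\<close>
        using assms(1) by (intro exI[of _ "x $ 1 / sqrt (\<kappa> z)"]) (simp add: field_simps)
    qed auto
    finally show ?thesis
      by (simp add: vec_eq_iff forall_2)
  qed
  then show ?thesis
    by (auto simp: span_singleton)
qed

text \<open>In the second coordinate the dual coefficient is
  \<open>\<kappa> (\<sigma> z) * A (\<sigma> (\<sigma> z))\<close>, and the involution law turns it
  into a multiple of \<open>A z\<close>, matching the lower left matrix entry. Membership of both
  sites in \<open>Z\<close> is what evaluates the restricted function
  \<open>normal_dir\<close>.\<close>

lemma normal_dir_orbit:
  assumes "z \<in> Z" and "\<sigma> z \<in> Z" and "\<sigma> (\<sigma> z) = z"
  shows "(vector [normal_dir Z \<sigma> \<kappa> K A z, normal_dir Z \<sigma> \<kappa> K A (\<sigma> z)] :: real^2) =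
    orbit_matrix \<sigma> \<kappa> K z *v vector [A z, A (\<sigma> z)]"
  using assms
  by (simp add: vec_eq_iff forall_2 normal_dir_def dual_coeff_def orbit_matrix_def
      matrix_vector_mult_def sum_2)

theorem lemma4p2:
  fixes Z :: "'z set" and \<sigma> :: "'z \<Rightarrow> 'z" and \<kappa> :: "'z \<Rightarrow> real" and K :: real
    and N :: nat and A :: "nat \<Rightarrow> 'z \<Rightarrow> real"
  assumes "finite Z"
    and "\<And>z. z \<in> Z \<Longrightarrow> \<sigma> z \<in> Z"
    and "\<And>z. z \<in> Z \<Longrightarrow> \<sigma> (\<sigma> z) = z"
    and "\<And>z. z \<in> Z \<Longrightarrow> \<kappa> z > 0"
    and "K > 0"
    and "\<And>z. z \<in> Z \<Longrightarrow> \<kappa> z * \<kappa> (\<sigma> z) = K"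
  shows "\<forall>z\<in>Z. \<sigma> z \<noteq> z \<longrightarrow>
      rank (orbit_matrix \<sigma> \<kappa> K z) = 1 \<and>
      range (\<lambda>x. orbit_matrix \<sigma> \<kappa> K z *v x) = span {orbit_dir \<sigma> \<kappa> z} \<and>
      {x. orbit_matrix \<sigma> \<kappa> K z *v x = 0} = span {vector [sqrt (\<kappa> z), sqrt (\<kappa> (\<sigma> z))]} \<and>
      (\<forall>\<nu>\<in>{1..N}. \<exists>t::real.
         (vector [normal_dir Z \<sigma> \<kappa> K (A \<nu>) z, normal_dir Z \<sigma> \<kappa> K (A \<nu>) (\<sigma> z)] :: real^2)
           = t *\<^sub>R orbit_dir \<sigma> \<kappa> z)"
proof (intro ballI impI conjI)
  fix z assume z: "z \<in> Z"
  have \<kappa>: "\<kappa> z > 0" "\<kappa> (\<sigma> z) > 0" "\<kappa> z * \<kappa> (\<sigma> z) = K"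
    using z assms by blast+
  show "rank (orbit_matrix \<sigma> \<kappa> K z) = 1"
    by (intro rank_orbit_matrix \<kappa>)
  show "range (\<lambda>x. orbit_matrix \<sigma> \<kappa> K z *v x) = span {orbit_dir \<sigma> \<kappa> z}"
    by (intro range_orbit_matrix \<kappa>)
  show "{x. orbit_matrix \<sigma> \<kappa> K z *v x = 0} = span {vector [sqrt (\<kappa> z), sqrt (\<kappa> (\<sigma> z))]}"
    by (intro kernel_orbit_matrix \<kappa>)
  fix \<nu>
  show "\<exists>t. (vector [normal_dir Z \<sigma> \<kappa> K (A \<nu>) z, normal_dir Z \<sigma> \<kappa> K (A \<nu>) (\<sigma> z)] :: real^2)
      = t *\<^sub>R orbit_dir \<sigma> \<kappa> z"
    \<comment> \<open>The pair lies in the image of the orbit matrix, so the factorisation displays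
      it as an explicit multiple of the orbit direction.\<close>
    unfolding normal_dir_orbit[OF z assms(2,3)[OF z]] orbit_matrix_mult_vec[of \<kappa> z \<sigma> K, OF \<kappa>] by blast
qed

end
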